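(* Consider a symmetric deterministic 2-receiver discrete memoryless broadcast channel with random state, where the state is known at both decoders and strictly causally at the encoder (stale state), and let $R_{\mathrm{sym-ts}}$ be the maximum symmetric rate achievable with the time-sharing scheme, i.e. with the time-sharing choice of auxiliary random variables (as defined in the context). Then $$R_{\mathrm{sym-ts}}=\max_{p(x)}\frac{C_1\, I(X;Y_1,Y_2|S)}{2C_1+I(X;Y_2|Y_1,S)},\qquad\text{where } C_1=\max_{p(x)}I(X;Y_1|S),$$ the maxima being over pmfs $p(x)$ on $\mathcal X$, with $X$ independent of $S\sim p(s)$ and $Y_i=y_i(X,S)$.
   Context: All alphabets are finite. A 2-receiver discrete memoryless broadcast channel (DM-BC) with random state consists of an input alphabet $\mathcal X$, output alphabets $\mathcal Y_1,\mathcal Y_2$, a state $S\sim p(s)$ on $\mathcal S$, and a conditional pmf $p(y_1,y_2|x,s)$. It is symmetric if $\mathcal Y_1=\mathcal Y_2=\mathcal Y$, $\mathcal S=\{1,\dots,|\mathcal S|\}$, and there is a bijection $\pi:\mathcal S\to\mathcal S$ with $p_S(s)=p_S(\pi(s))$ and $p_{Y_1|X,S}(y|x,s)=p_{Y_2|X,S}(y|x,\pi(s))$ for all $x,y,s$. It is symmetric deterministic if in addition $Y_1=y_1(X,S)$ and $Y_2=y_2(X,S)$ for deterministic functions $y_1,y_2$. Auxiliary random variables: a choice of auxiliaries is a tuple of finite-alphabet random variables $(U_0,U_1,U_2,V_0,V_1,V_2,Q)$ and a function $x(u_0,u_1,u_2,q)$ such that the joint pmf of all variables is $$p(q)\,p(u_0,u_1,u_2|q)\,\mathbf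 1_{x=x(u_0,u_1,u_2,q)}\,p(s)\,p(y_1,y_2|x,s)\,p(v_0,v_1,v_2|u_0,u_1,u_2,s,q).$$ For a choice of auxiliaries, the Shayevitz--Wigger inequalities (for state known at both decoders and strictly causally at the encoder) on nonnegative $(R_1,R_2)$ are $$ \begin{aligned} R_1 \le{}& I(U_0,U_1;Y_1,V_1|Q,S)-I(U_0,U_1,U_2;V_0,V_1|Q,Y_1,S),\\ R_2 \le{}& I(U_0,U_2;Y_2,V_2|Q,S)-I(U_0,U_1,U_2;V_0,V_2|Q,Y_2,S),\\ R_1+R_2 \le{}& I(U_1;Y_1,V_1|Q,U_0,S)+I(U_2;Y_2,V_2|Q,U_0,S)+\min_{i\in\{1,2\}}I(U_0;Y_i,V_i|Q,S)\\ &-I(U_1;U_2|Q,U_0)-I(U_0,U_1,U_2;V_1|Q,V_0,Y_1,S)-I(U_0,U_1,U_2;V_2|Q,V_0,Y_2,S)\\ &-\max_{i\in\{1,2\}}I(U_0,U_1,U_2;V_0|Q,Y_i,S),\\ R_1+R_2 \le{}& I(U_0,U_1;Y_1,V_1|Q,S)+I(U_0,U_2;Y_2,V_2|Q,S)-I(U_1;U_2|Q,U_0)\\ &-I(U_0,U_1,U_2;V_0,V_1|Q,Y_1,S)-I(U_0,U_1,U_2;V_0,V_2|Q,Y_2,S). \end{aligned} $$ Time-sharing choice: $Q\in\{1,2,3\}$ with $p_Q(1)=p_Q(2)=p$, $p_Q(3)=1-2p$, $0\le p\le 1/2$; $U_0,U_1,U_2$ take values in $\mathcal X$, with $p(q,u_0,u_1,u_2)=p(q)p(u_0)p(u_1)p(u_2)$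 and $p_{U_1}(u)=p_{U_2}(u)$ for all $u$; $V_0=V_1=V_2$ equals $Y_2$ if $Q=1$, $Y_1$ if $Q=2$, and a constant $\emptyset$ if $Q=3$; and $X=U_1$ if $Q=1$, $X=U_2$ if $Q=2$, $X=U_0$ if $Q=3$. (Since the channel is deterministic, the $V$'s are functions of $(U_0,U_1,U_2,S,Q)$.) $R_{\mathrm{sym-ts}}$ is the supremum of $R$ such that $(R,R)$ satisfies the four Shayevitz--Wigger inequalities for some time-sharing choice, i.e. some $p$, $p(u_0)$, and common pmf of $U_1,U_2$. *)

theory Defs
  imports "HOL-Probability.Probability"
begin

(* Information quantities are in bits.  The marginal spaces are the ones used by the
   notation I(X ; Y | Z) of the locale information_space. *)

definition cond_mi ::
  "'w pmf \<Rightarrow> ('w \<Rightarrow> 'a) \<Rightarrow> ('w \<Rightarrow> 'b) \<Rightarrow> ('w \<Rightarrow> 'c) \<Rightarrow> real" where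
  "cond_mi P X Y Z =
     prob_space.conditional_mutual_information (measure_pmf P) 2
       (count_space (range X)) (count_space (range Y)) (count_space (range Z)) X Y Z"

abbreviation rv_pair :: "('w \<Rightarrow> 'a) \<Rightarrow> ('w \<Rightarrow> 'b) \<Rightarrow> 'w \<Rightarrow> 'a \<times> 'b" (infixr "\<bowtie>" 65) where
  "X \<bowtie> Y \<equiv> (\<lambda>w. (X w, Y w))"

definition is_maximum :: "real set \<Rightarrow> real \<Rightarrow> bool" where
  "is_maximum A m \<longleftrightarrow> m \<in> A \<and> (\<forall>a\<in>A. a \<le> m)"


(* A broadcast channel with random state is a state pmf pS together with a kernel W,
   where W x s is the conditional pmf p(y1, y2 | x, s). *)

definition symmetric_bc ::
  "'s::finite pmf \<Rightarrow> ('x::finite \<Rightarrow> 's \<Rightarrow> ('y::finite \<times> 'y) pmf) \<Rightarrow> bool" where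
  "symmetric_bc pS W \<longleftrightarrow>
     (\<exists>\<pi>. bij \<pi> \<and> (\<forall>s. pmf pS s = pmf pS (\<pi> s)) \<and>
       (\<forall>x y s. pmf (map_pmf fst (W x s)) y = pmf (map_pmf snd (W x (\<pi> s))) y))"

definition symmetric_deterministic_bc ::
  "'s::finite pmf \<Rightarrow> ('x::finite \<Rightarrow> 's \<Rightarrow> ('y::finite \<times> 'y) pmf) \<Rightarrow>
    ('x \<Rightarrow> 's \<Rightarrow> 'y) \<Rightarrow> ('x \<Rightarrow> 's \<Rightarrow> 'y) \<Rightarrow> bool" where
  "symmetric_deterministic_bc pS W y1 y2 \<longleftrightarrow>
     symmetric_bc pS W \<and> (\<forall>x s. W x s = return_pmf (y1 x s, y2 x s))"


record ('q, 'u0, 'u1, 'u2, 'x, 's, 'v0, 'v1, 'v2) auxiliaries =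
  aux_q :: "'q pmf"
  aux_u :: "'q \<Rightarrow> ('u0 \<times> 'u1 \<times> 'u2) pmf"
  aux_x :: "'u0 \<Rightarrow> 'u1 \<Rightarrow> 'u2 \<Rightarrow> 'q \<Rightarrow> 'x"
  aux_v :: "'u0 \<Rightarrow> 'u1 \<Rightarrow> 'u2 \<Rightarrow> 's \<Rightarrow> 'q \<Rightarrow> ('v0 \<times> 'v1 \<times> 'v2) pmf"

record ('q, 'u0, 'u1, 'u2, 'x, 's, 'y1, 'y2, 'v0, 'v1, 'v2) outcome =
  rvQ :: 'q
  rvU0 :: 'u0
  rvU1 :: 'u1
  rvU2 :: 'u2
  rvX :: 'x
  rvS :: 's
  rvY1 :: 'y1
  rvY2 :: 'y2
  rvV0 :: 'v0
  rvV1 :: 'v1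
  rvV2 :: 'v2

definition joint_pmf ::
  "'s::finite pmf \<Rightarrow> ('x::finite \<Rightarrow> 's \<Rightarrow> ('y1::finite \<times> 'y2::finite) pmf) \<Rightarrow>
   ('q::finite, 'u0::finite, 'u1::finite, 'u2::finite, 'x, 's,
    'v0::finite, 'v1::finite, 'v2::finite) auxiliaries \<Rightarrow>
   ('q, 'u0, 'u1, 'u2, 'x, 's, 'y1, 'y2, 'v0, 'v1, 'v2) outcome pmf" where
  "joint_pmf pS W A =
     bind_pmf (aux_q A) (\<lambda>q.
     bind_pmf (aux_u A q) (\<lambda>(u0, u1, u2).
     bind_pmf pS (\<lambda>s.
     bind_pmf (W (aux_x A u0 u1 u2 q) s) (\<lambda>(y1, y2).
     bind_pmf (aux_v A u0 u1 u2 s q) (\<lambda>(v0, v1, v2).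
       return_pmf \<lparr>rvQ = q, rvU0 = u0, rvU1 = u1, rvU2 = u2, rvX = aux_x A u0 u1 u2 q,
         rvS = s, rvY1 = y1, rvY2 = y2, rvV0 = v0, rvV1 = v1, rvV2 = v2\<rparr>)))))"

definition sw_inequalities ::
  "'s::finite pmf \<Rightarrow> ('x::finite \<Rightarrow> 's \<Rightarrow> ('y1::finite \<times> 'y2::finite) pmf) \<Rightarrow>
   ('q::finite, 'u0::finite, 'u1::finite, 'u2::finite, 'x, 's,
    'v0::finite, 'v1::finite, 'v2::finite) auxiliaries \<Rightarrow>
   real \<Rightarrow> real \<Rightarrow> bool" where
  "sw_inequalities pS W A R1 R2 \<longleftrightarrow>
    (let P = joint_pmf pS W A; U = rvU0 \<bowtie> rvU1 \<bowtie> rvU2 in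
      0 \<le> R1 \<and> 0 \<le> R2 \<and>
      R1 \<le> cond_mi P (rvU0 \<bowtie> rvU1) (rvY1 \<bowtie> rvV1) (rvQ \<bowtie> rvS)
             - cond_mi P U (rvV0 \<bowtie> rvV1) (rvQ \<bowtie> rvY1 \<bowtie> rvS) \<and>
      R2 \<le> cond_mi P (rvU0 \<bowtie> rvU2) (rvY2 \<bowtie> rvV2) (rvQ \<bowtie> rvS)
             - cond_mi P U (rvV0 \<bowtie> rvV2) (rvQ \<bowtie> rvY2 \<bowtie> rvS) \<and>
      R1 + R2 \<le> cond_mi P rvU1 (rvY1 \<bowtie> rvV1) (rvQ \<bowtie> rvU0 \<bowtie> rvS)
             + cond_mi P rvU2 (rvY2 \<bowtie> rvV2) (rvQ \<bowtie> rvU0 \<bowtie> rvS)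
             + min (cond_mi P rvU0 (rvY1 \<bowtie> rvV1) (rvQ \<bowtie> rvS))
                   (cond_mi P rvU0 (rvY2 \<bowtie> rvV2) (rvQ \<bowtie> rvS))
             - cond_mi P rvU1 rvU2 (rvQ \<bowtie> rvU0)
             - cond_mi P U rvV1 (rvQ \<bowtie> rvV0 \<bowtie> rvY1 \<bowtie> rvS)
             - cond_mi P U rvV2 (rvQ \<bowtie> rvV0 \<bowtie> rvY2 \<bowtie> rvS)
             - max (cond_mi P U rvV0 (rvQ \<bowtie> rvY1 \<bowtie> rvS))
                   (cond_mi P U rvV0 (rvQ \<bowtie> rvY2 \<bowtie> rvS)) \<and>
      R1 + R2 \<le> cond_mi P (rvU0 \<bowtie> rvU1) (rvY1 \<bowtie> rvV1) (rvQ \<bowtie> rvS)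
             + cond_mi P (rvU0 \<bowtie> rvU2) (rvY2 \<bowtie> rvV2) (rvQ \<bowtie> rvS)
             - cond_mi P rvU1 rvU2 (rvQ \<bowtie> rvU0)
             - cond_mi P U (rvV0 \<bowtie> rvV1) (rvQ \<bowtie> rvY1 \<bowtie> rvS)
             - cond_mi P U (rvV0 \<bowtie> rvV2) (rvQ \<bowtie> rvY2 \<bowtie> rvS))"


datatype ts_index = Q1 | Q2 | Q3

instance ts_index :: finite
proof
  have "(UNIV :: ts_index set) \<subseteq> {Q1, Q2, Q3}"
    using ts_index.exhaust by blast
  then show "finite (UNIV :: ts_index set)"
    by (rule finite_subset) simp
qed

definition ts_index_pmf :: "real \<Rightarrow> ts_index pmf \<Rightarrow> bool" where
  "ts_index_pmf p pQ \<longleftrightarrow>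
     0 \<le> p \<and> p \<le> 1 / 2 \<and> pmf pQ Q1 = p \<and> pmf pQ Q2 = p \<and> pmf pQ Q3 = 1 - 2 * p"

fun ts_input :: "'x \<Rightarrow> 'x \<Rightarrow> 'x \<Rightarrow> ts_index \<Rightarrow> 'x" where
  "ts_input u0 u1 u2 Q1 = u1"
| "ts_input u0 u1 u2 Q2 = u2"
| "ts_input u0 u1 u2 Q3 = u0"

(* V0 = V1 = V2 is a function of (U0, U1, U2, S, Q) because the channel is deterministic;
   None is the constant symbol used in phase Q3. *)

fun ts_feedback :: "('x \<Rightarrow> 's \<Rightarrow> 'y) \<Rightarrow> ('x \<Rightarrow> 's \<Rightarrow> 'y) \<Rightarrow> 'x \<Rightarrow> 's \<Rightarrow> ts_index \<Rightarrow> 'y option" where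
  "ts_feedback y1 y2 x s Q1 = Some (y2 x s)"
| "ts_feedback y1 y2 x s Q2 = Some (y1 x s)"
| "ts_feedback y1 y2 x s Q3 = None"

(* p0 is the pmf of U0, and p12 is the common pmf of U1 and U2. *)

definition ts_auxiliaries ::
  "('x \<Rightarrow> 's \<Rightarrow> 'y) \<Rightarrow> ('x \<Rightarrow> 's \<Rightarrow> 'y) \<Rightarrow> ts_index pmf \<Rightarrow> 'x pmf \<Rightarrow> 'x pmf \<Rightarrow>
   (ts_index, 'x, 'x, 'x, 'x, 's, 'y option, 'y option, 'y option) auxiliaries" where
  "ts_auxiliaries y1 y2 pQ p0 p12 =
     \<lparr>aux_q = pQ,
      aux_u = (\<lambda>q. pair_pmf p0 (pair_pmf p12 p12)),
      aux_x = ts_input,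
      aux_v = (\<lambda>u0 u1 u2 s q.
        let v = ts_feedback y1 y2 (ts_input u0 u1 u2 q) s q in return_pmf (v, v, v))\<rparr>"

definition ts_symmetric_rates ::
  "'s::finite pmf \<Rightarrow> ('x::finite \<Rightarrow> 's \<Rightarrow> ('y::finite \<times> 'y) pmf) \<Rightarrow>
    ('x \<Rightarrow> 's \<Rightarrow> 'y) \<Rightarrow> ('x \<Rightarrow> 's \<Rightarrow> 'y) \<Rightarrow> real set" where
  "ts_symmetric_rates pS W y1 y2 =
     {R. \<exists>p pQ p0 p12. ts_index_pmf p pQ \<and>
           sw_inequalities pS W (ts_auxiliaries y1 y2 pQ p0 p12) R R}"

definition R_sym_ts ::
  "'s::finite pmf \<Rightarrow> ('x::finite \<Rightarrow> 's \<Rightarrow> ('y::finite \<times> 'y) pmf) \<Rightarrow>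
    ('x \<Rightarrow> 's \<Rightarrow> 'y) \<Rightarrow> ('x \<Rightarrow> 's \<Rightarrow> 'y) \<Rightarrow> real" where
  "R_sym_ts pS W y1 y2 = Sup (ts_symmetric_rates pS W y1 y2)"


record ('x, 's, 'y1, 'y2) single_use =
  inX :: 'x
  stS :: 's
  outY1 :: 'y1
  outY2 :: 'y2

definition single_use_pmf ::
  "'s pmf \<Rightarrow> ('x \<Rightarrow> 's \<Rightarrow> ('y1 \<times> 'y2) pmf) \<Rightarrow> 'x pmf \<Rightarrow> ('x, 's, 'y1, 'y2) single_use pmf" where
  "single_use_pmf pS W pX =
     bind_pmf pX (\<lambda>x. bind_pmf pS (\<lambda>s. bind_pmf (W x s) (\<lambda>(y1, y2).
       return_pmf \<lparr>inX = x, stS = s, outY1 = y1, outY2 = y2\<rparr>)))"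

definition mi_Y1 :: "'s pmf \<Rightarrow> ('x \<Rightarrow> 's \<Rightarrow> ('y1 \<times> 'y2) pmf) \<Rightarrow> 'x pmf \<Rightarrow> real" where
  "mi_Y1 pS W pX = cond_mi (single_use_pmf pS W pX) inX outY1 stS"

definition mi_Y1_Y2 :: "'s pmf \<Rightarrow> ('x \<Rightarrow> 's \<Rightarrow> ('y1 \<times> 'y2) pmf) \<Rightarrow> 'x pmf \<Rightarrow> real" where
  "mi_Y1_Y2 pS W pX = cond_mi (single_use_pmf pS W pX) inX (outY1 \<bowtie> outY2) stS"

definition mi_Y2_given_Y1 :: "'s pmf \<Rightarrow> ('x \<Rightarrow> 's \<Rightarrow> ('y1 \<times> 'y2) pmf) \<Rightarrow> 'x pmf \<Rightarrow> real" where
  "mi_Y2_given_Y1 pS W pX = cond_mi (single_use_pmf pS W pX) inX outY2 (outY1 \<bowtie> stS)"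

(* For a symmetric deterministic channel, C1 vanishes only if both outputs are functions of the state alone (up to null states); the
   denominator 2 * C1 + mi_Y2_given_Y1 is then 0 and the quotient reads as 0 / 0 = 0, which is
   also the symmetric rate of such a channel.  Otherwise the denominator is positive. *)

definition C1 :: "'s pmf \<Rightarrow> ('x \<Rightarrow> 's \<Rightarrow> ('y1 \<times> 'y2) pmf) \<Rightarrow> real" where
  "C1 pS W = (SUP pX. mi_Y1 pS W pX)"

end

theory Submission
  imports Defs
begin

text \<open>
  Write $A(r) = I(X;Y_1|S)$, $J(r) = I(X;Y_1,Y_2|S)$ and $D(r) = I(X;Y_2|Y_1,S)$ for $X \sim r$.  The
  channel is deterministic, so these are conditional entropies and $J = A + D$, and symmetry gives
  $H(Y_2|S) = H(Y_1|S)$.  Splitting every term over the phases $Q = 1, 2, 3$ turns the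
  Shayevitz--Wigger inequalities into $R \le p A(r) + (1-2p) A(p_0)$ and
  $2R \le p (J(r) + A(r)) + (1-2p) A(p_0)$; the other inequalities are consequences.  It is optimal
  to let $p_0$ attain $C_1$.  The first bound is then decreasing in $p$, and both bounds equal
  $C_1 J(r) / (2 C_1 + D(r))$ at $p = C_1 / (2 C_1 + D(r))$.  If the second bound is decreasing in
  $p$ as well, it is at most its value $C_1 / 2$ at $p = 0$, which the choice $r = p_0$ beats.  All
  maxima exist because entropies are continuous on the compact probability simplex.
\<close>

section \<open>Entropy of finitely valued random variables\<close>

text \<open>The summand of Shannon entropy in bits; the factor \<open>t\<close> builds in the
  convention 0 log 0 = 0.\<close>

definition eta :: "real \<Rightarrow> real" where
  "eta t = - t * log 2 t"

text \<open>Shannon entropy of \<open>X\<close>. The sum may run over the whole type since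
  \<open>eta 0 = 0\<close>, and the sample space stays arbitrary, so records of outcomes are
  covered.\<close>

definition ent :: "'w pmf \<Rightarrow> ('w \<Rightarrow> 'b::finite) \<Rightarrow> real" where
  "ent P X = (\<Sum>a\<in>UNIV. eta (pmf (map_pmf X P) a))"

lemma eta_nonneg: "0 \<le> t \<Longrightarrow> t \<le> 1 \<Longrightarrow> 0 \<le> eta t"
  unfolding eta_def by (cases "t = 0") (auto simp: mult_le_0_iff)

lemma eta_0 [simp]: "eta 0 = 0" and eta_1 [simp]: "eta 1 = 0"
  by (simp_all add: eta_def)

lemma eta_mult: "0 \<le> a \<Longrightarrow> 0 \<le> b \<Longrightarrow> eta (a * b) = a * eta b + b * eta a"
  unfolding eta_def by (cases "a = 0"; cases "b = 0") (auto simp: log_mult algebra_simps)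

lemma continuous_on_eta: "continuous_on {0..} eta"
  unfolding continuous_on_eq_continuous_within
proof
  fix t :: real assume "t \<in> {0..}"
  show "continuous (at t within {0..}) eta"
  proof (cases "t = 0")
    case True
    \<comment> \<open>Zero is the only delicate point: t log t tends to 0 from the right, which
      matches \<open>eta 0 = 0\<close>.\<close>
    have "((\<lambda>t::real. - t * log 2 t) \<longlongrightarrow> 0) (at_right 0)"
      by real_asymp
    then have "(eta \<longlongrightarrow> eta 0) (at_right 0)"
      by (simp add: eta_def[abs_def])
    moreover have "at (0::real) within {0..} = at_right 0"
      by (simp add: at_within_Ici_at_right)
    ultimately show ?thesis
      using True by (simp add: continuous_within)
  next
    case False
    then have "t > 0" using \<open>t \<in> {0..}\<close> by simp
    then have "isCont (\<lambda>t. - t * log 2 t) t"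
      by (intro continuous_intros) auto
    then show ?thesis
      by (auto simp: eta_def[abs_def] intro: continuous_at_imp_continuous_at_within)
  qed
qed

lemma sum_map_pmf:
  fixes P :: "'w pmf" and T :: "'w \<Rightarrow> 'b::finite" and f :: "'b \<Rightarrow> 'c::finite" and g :: "'c \<Rightarrow> real"
  shows "(\<Sum>t\<in>UNIV. pmf (map_pmf T P) t * g (f t)) = (\<Sum>u\<in>UNIV. pmf (map_pmf (\<lambda>w. f (T w)) P) u * g u)"
proof -
  have "(\<Sum>t\<in>UNIV. pmf (map_pmf T P) t * g (f t)) = (LINT t|map_pmf T P. g (f t))"
    by (subst integral_measure_pmf_real[of UNIV]) (auto simp: mult.commute)
  also have "\<dots> = (LINT u|map_pmf (\<lambda>w. f (T w)) P. g u)"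
    by simp
  also have "\<dots> = (\<Sum>u\<in>UNIV. pmf (map_pmf (\<lambda>w. f (T w)) P) u * g u)"
    by (subst integral_measure_pmf_real[of UNIV]) (auto simp: mult.commute)
  finally show ?thesis .
qed

text \<open>Writes the entropy of a marginal as an expectation under the joint law, so that
  entropies of several marginals can be combined under one sum.\<close>

lemma ent_alt:
  fixes P :: "'w pmf" and T :: "'w \<Rightarrow> 'b::finite" and f :: "'b \<Rightarrow> 'c::finite"
  shows "ent P (\<lambda>w. f (T w)) = - (\<Sum>t\<in>UNIV. pmf (map_pmf T P) t * log 2 (pmf (map_pmf (\<lambda>w. f (T w)) P) (f t)))"
  unfolding sum_map_pmf[of T P "\<lambda>u. log 2 (pmf (map_pmf (\<lambda>w. f (T w)) P) u)" f] ent_def eta_def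
  by (simp add: sum_negf)

lemma pmf_map_pos: "0 < pmf (map_pmf T P) t \<Longrightarrow> 0 < pmf (map_pmf (\<lambda>w. f (T w)) P) (f t)"
  by (simp add: pmf_positive_iff) (auto simp: image_iff intro!: imageI)

lemma simple_distributed_pmf:
  fixes X :: "'w \<Rightarrow> 'b::finite"
  shows "simple_distributed (measure_pmf P) X (pmf (map_pmf X P))"
  by (rule measure_pmf.simple_distributedI)
    (auto simp: simple_function_def pmf_map finite_subset[OF subset_UNIV])

text \<open>The logarithm of the density ratio splits into four, and each averages to an entropy up
  to sign. This gives access to chain rules.\<close>

lemma cond_mi_eq_ent:
  fixes X :: "'w \<Rightarrow> 'a::finite" and Y :: "'w \<Rightarrow> 'b::finite" and Z :: "'w \<Rightarrow> 'c::finite"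
  shows "cond_mi P X Y Z = ent P (X \<bowtie> Z) + ent P (Y \<bowtie> Z) - ent P (X \<bowtie> Y \<bowtie> Z) - ent P Z"
proof -
  interpret information_space "measure_pmf P" 2
    by unfold_locales auto
  let ?T = "X \<bowtie> Y \<bowtie> Z"
  let ?p = "\<lambda>V. pmf (map_pmf V P)"
  have "cond_mi P X Y Z = (\<Sum>(x, y, z)\<in>range ?T. ?p ?T (x, y, z) *
      log 2 (?p ?T (x, y, z) / (?p (X \<bowtie> Z) (x, z) * (?p (Y \<bowtie> Z) (y, z) / ?p Z z))))"
    using conditional_mutual_information_eq[OF simple_distributed_pmf simple_distributed_pmf
        simple_distributed_pmf simple_distributed_pmf, of X Y Z]
    by (simp add: cond_mi_def)
  also have "\<dots> = (\<Sum>(x, y, z)\<in>UNIV. ?p ?T (x, y, z) *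
      log 2 (?p ?T (x, y, z) / (?p (X \<bowtie> Z) (x, z) * (?p (Y \<bowtie> Z) (y, z) / ?p Z z))))"
    by (rule sum.mono_neutral_left) (auto intro!: pmf_map_outside)
  also have "\<dots> = (\<Sum>t\<in>UNIV. ?p ?T t * log 2 (?p ?T t) + ?p ?T t * log 2 (?p Z (snd (snd t)))
      - ?p ?T t * log 2 (?p (X \<bowtie> Z) (fst t, snd (snd t))) - ?p ?T t * log 2 (?p (Y \<bowtie> Z) (snd t)))"
  proof (intro sum.cong refl)
    fix t :: "'a \<times> 'b \<times> 'c"
    obtain x y z where t: "t = (x, y, z)" by (cases t)
    show "(case t of (x, y, z) \<Rightarrow> ?p ?T (x, y, z) *
      log 2 (?p ?T (x, y, z) / (?p (X \<bowtie> Z) (x, z) * (?p (Y \<bowtie> Z) (y, z) / ?p Z z)))) =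
      ?p ?T t * log 2 (?p ?T t) + ?p ?T t * log 2 (?p Z (snd (snd t)))
      - ?p ?T t * log 2 (?p (X \<bowtie> Z) (fst t, snd (snd t))) - ?p ?T t * log 2 (?p (Y \<bowtie> Z) (snd t))"
    \<comment> \<open>A point of zero mass contributes 0 to both sides; elsewhere all marginals are
      positive too, so the logarithm splits.\<close>
    proof (cases "?p ?T t = 0")
      case True
      then show ?thesis by (simp add: t)
    next
      case False
      then have 1: "0 < ?p ?T t" by (simp add: less_le)
      have "0 < ?p (X \<bowtie> Z) (x, z)" "0 < ?p (Y \<bowtie> Z) (y, z)" "0 < ?p Z z"
        using pmf_map_pos[OF 1, of "\<lambda>(x, y, z). (x, z)"] pmf_map_pos[OF 1, of snd]
          pmf_map_pos[OF 1, of "\<lambda>t. snd (snd t)"] by (simp_all add: t)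
      with 1 show ?thesis
        by (simp add: t log_divide log_mult algebra_simps)
    qed
  qed
  also have "\<dots> = ent P (X \<bowtie> Z) + ent P (Y \<bowtie> Z) - ent P ?T - ent P Z"
    using ent_alt[of P "\<lambda>t. t" ?T] ent_alt[of P "\<lambda>t. (fst t, snd (snd t))" ?T] ent_alt[of P snd ?T]
      ent_alt[of P "\<lambda>t. snd (snd t)" ?T]
    by (simp add: sum.distrib sum_subtractf)
  finally show ?thesis .
qed

lemma cond_mi_nonneg:
  fixes X :: "'w \<Rightarrow> 'a::finite" and Y :: "'w \<Rightarrow> 'b::finite" and Z :: "'w \<Rightarrow> 'c::finite"
  shows "0 \<le> cond_mi P X Y Z"
proof -
  interpret information_space "measure_pmf P" 2
    by unfold_locales auto
  have "simple_function (measure_pmf P) V" for V :: "'w \<Rightarrow> 'd::finite"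
    by (auto simp: simple_function_def finite_subset[OF subset_UNIV])
  from conditional_mutual_information_nonneg[OF this this this] show ?thesis
    by (simp add: cond_mi_def)
qed

lemma ent_nonneg: "0 \<le> ent P X"
  unfolding ent_def by (intro sum_nonneg eta_nonneg) (auto simp: pmf_le_1)

lemma ent_map_pmf: "ent (map_pmf f P) X = ent P (\<lambda>w. X (f w))"
  by (simp add: ent_def map_pmf_comp)

text \<open>
  Random variables are compared through their kernels, so that relabellings such as
  \<open>Some y\<close> versus \<open>y\<close>, or repeated and reordered components of a tuple, need no explicit
  bijection.
\<close>

lemma ent_inj:
  fixes X :: "'w \<Rightarrow> 'b::finite" and Y :: "'w \<Rightarrow> 'c::finite"
  assumes "\<And>w w'. w \<in> set_pmf P \<Longrightarrow> w' \<in> set_pmf P \<Longrightarrow> X w = X w' \<longleftrightarrow> Y w = Y w'"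
  shows "ent P X = ent P Y"
proof -
  \<comment> \<open>Chooses a representative of each fibre of \<open>X\<close>; as \<open>X\<close>
    and \<open>Y\<close> have the same fibres on the support, \<open>f\<close> carries
    \<open>X\<close> to \<open>Y\<close> injectively there.\<close>
  define f where "f a = Y (SOME w. w \<in> set_pmf P \<and> X w = a)" for a
  have f: "f (X w) = Y w" if "w \<in> set_pmf P" for w
  proof -
    have "(SOME w'. w' \<in> set_pmf P \<and> X w' = X w) \<in> set_pmf P \<and>
        X (SOME w'. w' \<in> set_pmf P \<and> X w' = X w) = X w"
      by (rule someI) (use that in auto)
    then show ?thesis
      using assms that by (auto simp: f_def)
  qed
  let ?M = "map_pmf X P"
  have inj: "inj_on f (set_pmf ?M)"
    by (auto simp: inj_on_def f assms)
  have Y: "map_pmf Y P = map_pmf f ?M"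
    by (auto simp: map_pmf_comp f intro!: map_pmf_cong)
  have "ent P Y = (\<Sum>b\<in>f ` set_pmf ?M. eta (pmf (map_pmf f ?M) b))"
    unfolding ent_def Y by (rule sum.mono_neutral_right) (auto simp: pmf_map_outside)
  also have "\<dots> = (\<Sum>a\<in>set_pmf ?M. eta (pmf ?M a))"
    by (subst sum.reindex[OF inj]) (auto intro!: sum.cong simp del: set_map_pmf simp: pmf_map_inj[OF inj])
  also have "\<dots> = ent P X"
    unfolding ent_def by (rule sum.mono_neutral_left) (auto simp: pmf_map_outside)
  finally show ?thesis by simp
qed

section \<open>Mixtures over a recoverable label\<close>

lemma pmf_pair_image:
  "pmf (map_pmf (\<lambda>w. (F w, q)) M) (a, q') = (if q = q' then pmf (map_pmf F M) a else 0)"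
  by (auto simp: pmf_map vimage_def)

text \<open>The chain rule H(F,Q) = H(Q) + H(F|Q). The hypothesis makes the label recoverable from
  the outcome, so \<open>K q\<close> is the conditional law given the label
  \<open>q\<close>.\<close>

lemma ent_bind_pmf:
  fixes p :: "'q::finite pmf" and F :: "'w \<Rightarrow> 'b::finite"
  assumes "\<And>q w. q \<in> set_pmf p \<Longrightarrow> w \<in> set_pmf (K q) \<Longrightarrow> Q w = q"
  shows "ent (bind_pmf p K) (F \<bowtie> Q) = ent p (\<lambda>q. q) + (\<Sum>q\<in>UNIV. pmf p q * ent (K q) F)"
proof -
  have eq: "pmf (map_pmf (F \<bowtie> Q) (bind_pmf p K)) (a, q) = pmf p q * pmf (map_pmf F (K q)) a" for a q
  proof -
    have "map_pmf (F \<bowtie> Q) (bind_pmf p K) = bind_pmf p (\<lambda>q. map_pmf (\<lambda>w. (F w, q)) (K q))"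
      unfolding map_bind_pmf by (intro bind_pmf_cong map_pmf_cong refl) (auto simp: assms)
    also have "pmf \<dots> (a, q) = (\<Sum>q'\<in>UNIV. pmf (map_pmf (\<lambda>w. (F w, q')) (K q')) (a, q) * pmf p q')"
      unfolding pmf_bind by (rule integral_measure_pmf_real) auto
    \<comment> \<open>The tag keeps the components disjoint, so only \<open>q' = q\<close>
      contributes.\<close>
    also have "\<dots> = (\<Sum>q'\<in>UNIV. if q' = q then pmf (map_pmf F (K q)) a * pmf p q else 0)"
      by (intro sum.cong) (auto simp: pmf_pair_image)
    finally show ?thesis by simp
  qed
  have "ent (bind_pmf p K) (F \<bowtie> Q) = (\<Sum>(a, q)\<in>UNIV \<times> UNIV. eta (pmf p q * pmf (map_pmf F (K q)) a))"
    unfolding ent_def eq[symmetric] by (intro sum.cong) auto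
  also have "\<dots> = (\<Sum>q\<in>UNIV. \<Sum>a\<in>UNIV. eta (pmf p q * pmf (map_pmf F (K q)) a))"
    unfolding sum.cartesian_product[symmetric] by (rule sum.swap)
  also have "\<dots> = (\<Sum>q\<in>UNIV. pmf p q * ent (K q) F + (\<Sum>a\<in>UNIV. pmf (map_pmf F (K q)) a) * eta (pmf p q))"
    unfolding ent_def sum_distrib_left sum_distrib_right by (simp add: eta_mult sum.distrib)
  also have "\<dots> = ent p (\<lambda>q. q) + (\<Sum>q\<in>UNIV. pmf p q * ent (K q) F)"
    by (simp add: sum_pmf_eq_1 ent_def sum.distrib map_pmf_ident)
  finally show ?thesis .
qed

text \<open>Each of the four entropies contributes H(Q) once, with cancelling signs; what remains is
  the average over the labels.\<close>

lemma cond_mi_bind_pmf: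
  fixes p :: "'q::finite pmf" and X :: "'w \<Rightarrow> 'a::finite" and Y :: "'w \<Rightarrow> 'b::finite" and Z :: "'w \<Rightarrow> 'c::finite"
  assumes "\<And>q w. q \<in> set_pmf p \<Longrightarrow> w \<in> set_pmf (K q) \<Longrightarrow> Q w = q"
  shows "cond_mi (bind_pmf p K) X Y (Q \<bowtie> Z) = (\<Sum>q\<in>UNIV. pmf p q * cond_mi (K q) X Y Z)"
proof -
  let ?P = "bind_pmf p K"
  have "ent ?P (X \<bowtie> Q \<bowtie> Z) = ent ?P ((X \<bowtie> Z) \<bowtie> Q)" "ent ?P (Y \<bowtie> Q \<bowtie> Z) = ent ?P ((Y \<bowtie> Z) \<bowtie> Q)"
    "ent ?P (X \<bowtie> Y \<bowtie> Q \<bowtie> Z) = ent ?P ((X \<bowtie> Y \<bowtie> Z) \<bowtie> Q)" "ent ?P (Q \<bowtie> Z) = ent ?P (Z \<bowtie> Q)"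
    by (auto intro!: ent_inj)
  then show ?thesis
    unfolding cond_mi_eq_ent
    by (simp add: ent_bind_pmf[of p K Q, OF assms] sum.distrib sum_subtractf algebra_simps)
qed

lemma cond_mi_map_pmf:
  fixes X :: "'w \<Rightarrow> 'a::finite" and Y :: "'w \<Rightarrow> 'b::finite" and Z :: "'w \<Rightarrow> 'c::finite"
  shows "cond_mi (map_pmf f P) X Y Z = cond_mi P (\<lambda>w. X (f w)) (\<lambda>w. Y (f w)) (\<lambda>w. Z (f w))"
  by (simp add: cond_mi_eq_ent ent_map_pmf)


section \<open>Independent and deterministic observations\<close>

lemma ent_pair_pmf:
  fixes F :: "'a \<Rightarrow> 'c::finite" and G :: "'b \<Rightarrow> 'd::finite"
  shows "ent (pair_pmf A B) (\<lambda>w. (F (fst w), G (snd w))) = ent A F + ent B G"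
proof -
  let ?a = "pmf (map_pmf F A)" and ?b = "pmf (map_pmf G B)"
  have "map_pmf (\<lambda>w. (F (fst w), G (snd w))) (pair_pmf A B) = pair_pmf (map_pmf F A) (map_pmf G B)"
    by (simp add: map_pair[symmetric] case_prod_beta')
  then have "ent (pair_pmf A B) (\<lambda>w. (F (fst w), G (snd w))) = (\<Sum>(a, b)\<in>UNIV \<times> UNIV. eta (?a a * ?b b))"
    unfolding ent_def by (intro sum.cong) (auto simp: pmf_pair)
  also have "\<dots> = (\<Sum>a\<in>UNIV. \<Sum>b\<in>UNIV. eta (?a a * ?b b))"
    by (simp add: sum.cartesian_product)
  also have "\<dots> = (\<Sum>a\<in>UNIV. ?a a * ent B G + (\<Sum>b\<in>UNIV. ?b b) * eta (?a a))"
    unfolding ent_def sum_distrib_left sum_distrib_right by (simp add: eta_mult sum.distrib)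
  also have "\<dots> = ent A F + ent B G"
    by (simp add: sum_pmf_eq_1 sum.distrib ent_def[of A] flip: sum_distrib_right)
  finally show ?thesis .
qed

lemma cond_mi_pair_pmf:
  fixes F :: "'a \<Rightarrow> 'c::finite" and G :: "'b \<Rightarrow> 'd::finite" and H :: "'b \<Rightarrow> 'e::finite"
  shows "cond_mi (pair_pmf A B) (\<lambda>w. F (fst w)) (\<lambda>w. G (snd w)) (\<lambda>w. H (snd w)) = 0"
proof -
  have snd: "ent (pair_pmf A B) (\<lambda>w. V (snd w)) = ent B V" for V :: "'b \<Rightarrow> 'f::finite"
    using ent_map_pmf[of snd "pair_pmf A B" V] by (simp add: map_snd_pair_pmf)
  show ?thesis
    unfolding cond_mi_eq_ent
    using ent_pair_pmf[of A B F H] ent_pair_pmf[of A B F "G \<bowtie> H"] snd[of H] snd[of "G \<bowtie> H"] by simp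
qed

lemma factor_through:
  assumes "\<And>w w'. c w = c w' \<Longrightarrow> V w = V w'"
  obtains F where "\<And>w. V w = F (c w)"
proof
  show "V w = V (SOME w'. c w' = c w)" for w
    by (rule assms) (metis (mono_tags, lifting) someI)
qed

text \<open>An independence criterion stated through kernels: \<open>X\<close> depends only on
  \<open>a\<close>, while \<open>Y\<close> and \<open>Z\<close> depend only on \<open>b\<close>. The
  functions expressing this dependence need not be named when the lemma is applied.\<close>

lemma cond_mi_eq_0_indep:
  fixes X :: "'w \<Rightarrow> 'c::finite" and Y :: "'w \<Rightarrow> 'd::finite" and Z :: "'w \<Rightarrow> 'e::finite"
  assumes M: "map_pmf (\<lambda>w. (a w, b w)) M = pair_pmf A B"
    and X: "\<And>w w'. a w = a w' \<Longrightarrow> X (g w) = X (g w')"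
    and Y: "\<And>w w'. b w = b w' \<Longrightarrow> Y (g w) = Y (g w')"
    and Z: "\<And>w w'. b w = b w' \<Longrightarrow> Z (g w) = Z (g w')"
  shows "cond_mi (map_pmf g M) X Y Z = 0"
proof -
  obtain F where "\<And>w. X (g w) = F (a w)" using factor_through[of a "\<lambda>w. X (g w)", OF X] by blast
  moreover obtain G where "\<And>w. Y (g w) = G (b w)" using factor_through[of b "\<lambda>w. Y (g w)", OF Y] by blast
  moreover obtain H where "\<And>w. Z (g w) = H (b w)" using factor_through[of b "\<lambda>w. Z (g w)", OF Z] by blast
  ultimately have "cond_mi (map_pmf g M) X Y Z = cond_mi (map_pmf (\<lambda>w. (a w, b w)) M)
      (\<lambda>w. F (fst w)) (\<lambda>w. G (snd w)) (\<lambda>w. H (snd w))"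
    by (simp add: cond_mi_map_pmf)
  then show ?thesis
    by (simp add: M cond_mi_pair_pmf)
qed

text \<open>\<open>Y\<close> is determined by \<open>X\<close> and \<open>Z\<close>, so H(Y|X,Z) = 0
  and the information is H(Y|Z).\<close>

lemma cond_mi_function:
  fixes X :: "'w \<Rightarrow> 'c::finite" and Y :: "'w \<Rightarrow> 'd::finite" and Z :: "'w \<Rightarrow> 'e::finite"
  assumes "\<And>w w'. X (g w) = X (g w') \<Longrightarrow> Z (g w) = Z (g w') \<Longrightarrow> Y (g w) = Y (g w')"
  shows "cond_mi (map_pmf g M) X Y Z = ent M (\<lambda>w. (Y (g w), Z (g w))) - ent M (\<lambda>w. Z (g w))"
proof -
  have "ent M (\<lambda>w. (X (g w), Y (g w), Z (g w))) = ent M (\<lambda>w. (X (g w), Z (g w)))"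
    by (rule ent_inj, unfold prod.inject) (blast intro: assms)
  then show ?thesis
    by (simp add: cond_mi_eq_ent ent_map_pmf)
qed

lemma cond_mi_eq_0_function:
  fixes X :: "'w \<Rightarrow> 'c::finite" and Y :: "'w \<Rightarrow> 'd::finite" and Z :: "'w \<Rightarrow> 'e::finite"
  assumes "\<And>w w'. Z (g w) = Z (g w') \<Longrightarrow> Y (g w) = Y (g w')"
  shows "cond_mi (map_pmf g M) X Y Z = 0"
proof -
  have "ent M (\<lambda>w. (Y (g w), Z (g w))) = ent M (\<lambda>w. Z (g w))"
    by (rule ent_inj, unfold prod.inject) (blast intro: assms)
  moreover have "cond_mi (map_pmf g M) X Y Z = ent M (\<lambda>w. (Y (g w), Z (g w))) - ent M (\<lambda>w. Z (g w))"
    by (rule cond_mi_function) (rule assms)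
  ultimately show ?thesis by simp
qed

text \<open>The conditional entropy H(f(U,S)|S) for U with law \<open>r\<close>, independent of the
  state S with law \<open>pS\<close>.\<close>

definition cond_ent :: "'s::finite pmf \<Rightarrow> 'u pmf \<Rightarrow> ('u \<Rightarrow> 's \<Rightarrow> 'b::finite) \<Rightarrow> real" where
  "cond_ent pS r f = (\<Sum>s\<in>UNIV. pmf pS s * ent r (\<lambda>u. f u s))"

lemma ent_pair_pmf_state:
  "ent (pair_pmf U pS) (\<lambda>w. (f (fst w) (snd w), snd w)) = ent pS (\<lambda>s. s) + cond_ent pS U f"
proof -
  \<comment> \<open>Drawing the state first presents the product as a mixture over states, to which
    the chain rule applies.\<close>
  have "pair_pmf U pS = bind_pmf pS (\<lambda>s. map_pmf (\<lambda>u. (u, s)) U)"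
    unfolding pair_pmf_def map_pmf_def by (rule bind_commute_pmf)
  then have "ent (pair_pmf U pS) (\<lambda>w. (f (fst w) (snd w), snd w)) = ent pS (\<lambda>s. s) +
      (\<Sum>s\<in>UNIV. pmf pS s * ent (map_pmf (\<lambda>u. (u, s)) U) (\<lambda>w. f (fst w) (snd w)))"
    by (simp only:) (rule ent_bind_pmf, auto)
  then show ?thesis
    by (simp add: cond_ent_def ent_map_pmf)
qed

lemma cond_ent_map_pmf: "cond_ent pS (map_pmf c U) f = cond_ent pS U (\<lambda>u. f (c u))"
  by (simp add: cond_ent_def ent_map_pmf)

lemma ent_const: "ent P (\<lambda>_. c) = 0"
  by (auto simp: ent_def indicator_def intro!: sum.neutral)

lemma cond_ent_const: "cond_ent pS r (\<lambda>_ _. c) = 0"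
  by (simp add: cond_ent_def ent_const)

lemma cond_ent_nonneg: "0 \<le> cond_ent pS r f"
  by (auto simp: cond_ent_def intro!: sum_nonneg mult_nonneg_nonneg ent_nonneg)

lemma cond_ent_pair_pmf:
  "cond_ent pS (pair_pmf p r) (\<lambda>u s. (fst u, f (snd u) s)) = ent p (\<lambda>u. u) + cond_ent pS r f"
proof -
  have "ent (pair_pmf p r) (\<lambda>u. (fst u, f (snd u) s)) = ent p (\<lambda>u. u) + ent r (\<lambda>u. f u s)" for s
    by (rule ent_pair_pmf)
  then show ?thesis
    by (simp add: cond_ent_def sum.distrib distrib_left sum_pmf_eq_1 flip: sum_distrib_right)
qed

lemma cond_ent_pair_pmf_fst:
  "cond_ent pS (pair_pmf p r) (\<lambda>u s. fst u) = ent p (\<lambda>u. u)"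
  using ent_map_pmf[of fst "pair_pmf p r" "\<lambda>u. u"]
  by (simp add: cond_ent_def map_fst_pair_pmf sum_pmf_eq_1 flip: sum_distrib_right)

text \<open>Evaluates the nonzero terms of a deterministic channel. \<open>c\<close> extracts the
  part of the source that matters; together with the state, \<open>f\<close> carries the same
  information as \<open>Y\<close> and \<open>Z\<close>, and \<open>f'\<close> the same as
  \<open>Z\<close>. The two copies of H(S) cancel.\<close>

lemma cond_mi_eq_cond_ent:
  fixes X :: "'w \<Rightarrow> 'c::finite" and Y :: "'w \<Rightarrow> 'd::finite" and Z :: "'w \<Rightarrow> 'e::finite"
    and f :: "'t \<Rightarrow> 's::finite \<Rightarrow> 'b1::finite" and f' :: "'t \<Rightarrow> 's \<Rightarrow> 'b2::finite"
  assumes r: "map_pmf c U = r"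
    and X: "\<And>w w'. X (g w) = X (g w') \<Longrightarrow> Z (g w) = Z (g w') \<Longrightarrow> Y (g w) = Y (g w')"
    and YZ: "\<And>u s u' s'. (Y (g (u, s)) = Y (g (u', s')) \<and> Z (g (u, s)) = Z (g (u', s')))
      \<longleftrightarrow> (f (c u) s = f (c u') s' \<and> s = s')"
    and Z: "\<And>u s u' s'. Z (g (u, s)) = Z (g (u', s')) \<longleftrightarrow> (f' (c u) s = f' (c u') s' \<and> s = s')"
  shows "cond_mi (map_pmf g (pair_pmf U pS)) X Y Z = cond_ent pS r f - cond_ent pS r f'"
proof -
  have "ent (pair_pmf U pS) (\<lambda>w. (Y (g w), Z (g w))) = ent (pair_pmf U pS) (\<lambda>w. (f (c (fst w)) (snd w), snd w))"
    by (rule ent_inj) (use YZ in \<open>simp add: split_paired_all prod_eq_iff\<close>)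
  moreover have "ent (pair_pmf U pS) (\<lambda>w. Z (g w)) = ent (pair_pmf U pS) (\<lambda>w. (f' (c (fst w)) (snd w), snd w))"
    by (rule ent_inj) (use Z in \<open>simp add: split_paired_all prod_eq_iff\<close>)
  ultimately show ?thesis
    using cond_mi_function[of X g Z Y "pair_pmf U pS", OF X]
    by (simp add: ent_pair_pmf_state[of _ _ "\<lambda>u. f (c u)"] ent_pair_pmf_state[of _ _ "\<lambda>u. f' (c u)"]
        cond_ent_map_pmf flip: r)
qed

section \<open>Maxima over probability mass functions\<close>

text \<open>The coordinate vectors of pmfs, placed in Euclidean space so that compactness and
  continuity yield maxima.\<close>

definition prob_simplex :: "(real ^ 'x::finite) set" where
  "prob_simplex = {v. (\<forall>i. 0 \<le> v $ i) \<and> (\<Sum>i\<in>UNIV. v $ i) = 1}"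

lemma vec_pmf_in_simplex: "(\<chi> i. pmf r i) \<in> prob_simplex"
  by (simp add: prob_simplex_def sum_pmf_eq_1)

lemma simplex_vec_pmfE:
  assumes "v \<in> prob_simplex"
  obtains r where "v = (\<chi> i. pmf r i)"
proof
  have "(\<integral>\<^sup>+ x. ennreal (v $ x) \<partial>count_space UNIV) = 1"
    using assms by (simp add: prob_simplex_def nn_integral_count_space_finite sum_ennreal)
  with assms have "pmf (embed_pmf (($) v)) i = v $ i" for i
    by (intro pmf_embed_pmf) (auto simp: prob_simplex_def)
  then show "v = (\<chi> i. pmf (embed_pmf (($) v)) i)"
    by (simp add: vec_eq_iff)
qed

lemma compact_prob_simplex: "compact (prob_simplex :: (real ^ 'x::finite) set)"
proof (rule compact_eq_bounded_closed[THEN iffD2], rule conjI)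
  have "closed {v :: real ^ 'x. \<forall>i. 0 \<le> v $ i}"
    by (simp only: Collect_all_eq) (intro closed_INT ballI closed_Collect_le continuous_intros)
  moreover have "closed {v :: real ^ 'x. (\<Sum>i\<in>UNIV. v $ i) = 1}"
    by (intro closed_Collect_eq continuous_intros)
  ultimately show "closed (prob_simplex :: (real ^ 'x) set)"
    by (simp add: prob_simplex_def Collect_conj_eq closed_Int)
  \<comment> \<open>The l1 norm dominates the Euclidean norm and equals the coordinate sum 1 on the
    simplex.\<close>
  have "norm v \<le> 1" if "v \<in> prob_simplex" for v :: "real ^ 'x"
    using norm_le_l1_cart[of v] that by (simp add: prob_simplex_def)
  then show "bounded (prob_simplex :: (real ^ 'x) set)"
    by (auto simp: bounded_iff)
qed

lemma pmf_maximum_exists: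
  fixes f :: "'x::finite pmf \<Rightarrow> real"
  assumes "continuous_on prob_simplex g" "\<And>r. f r = g (\<chi> i. pmf r i)"
  shows "\<exists>r. \<forall>r'. f r' \<le> f r"
proof -
  have "prob_simplex \<noteq> ({} :: (real ^ 'x) set)"
    using vec_pmf_in_simplex[of "return_pmf undefined :: 'x pmf"] by auto
  then obtain v where "v \<in> prob_simplex" "\<And>w. w \<in> prob_simplex \<Longrightarrow> g w \<le> g v"
    using continuous_attains_sup[OF compact_prob_simplex _ assms(1)] by blast
  then show ?thesis
    by (metis assms(2) simplex_vec_pmfE vec_pmf_in_simplex)
qed

text \<open>\<open>cond_ent\<close> in coordinates: masses of the push-forward are sums over fibres,
  hence linear in \<open>v\<close>, which exposes continuity.\<close>

definition cond_ent_vec :: "'s::finite pmf \<Rightarrow> ('x::finite \<Rightarrow> 's \<Rightarrow> 'b::finite) \<Rightarrow> real ^ 'x \<Rightarrow> real" where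
  "cond_ent_vec pS f v = (\<Sum>s\<in>UNIV. pmf pS s * (\<Sum>a\<in>UNIV. eta (\<Sum>x | f x s = a. v $ x)))"

lemma cond_ent_eq_vec: "cond_ent pS r f = cond_ent_vec pS f (\<chi> i. pmf r i)"
  by (simp add: cond_ent_def cond_ent_vec_def ent_def pmf_map vimage_def measure_measure_pmf_finite)

lemma continuous_on_cond_ent_vec: "continuous_on prob_simplex (cond_ent_vec pS f)"
  unfolding cond_ent_vec_def
  by (intro continuous_intros continuous_on_compose2[OF continuous_on_eta])
    (auto simp: prob_simplex_def intro!: sum_nonneg)

section \<open>The time-sharing scheme\<close>

lemma single_use_pmf_deterministic:
  assumes "\<And>x s. W x s = return_pmf (y1 x s, y2 x s)"
  shows "single_use_pmf pS W pX =
    map_pmf (\<lambda>(x, s). \<lparr>inX = x, stS = s, outY1 = y1 x s, outY2 = y2 x s\<rparr>) (pair_pmf pX pS)"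
  by (simp add: single_use_pmf_def assms pair_pmf_def map_bind_pmf bind_return_pmf)

text \<open>On a deterministic channel the whole outcome of phase \<open>q\<close> is a function of
  U0, U1, U2 and the state; all remaining randomness lies in \<open>ts_source\<close>.\<close>

definition ts_outcome where
  "ts_outcome y1 y2 q = (\<lambda>((u0, u1, u2), s).
     let x = ts_input u0 u1 u2 q; v = ts_feedback y1 y2 x s q in
       \<lparr>rvQ = q, rvU0 = u0, rvU1 = u1, rvU2 = u2, rvX = x, rvS = s, rvY1 = y1 x s, rvY2 = y2 x s,
        rvV0 = v, rvV1 = v, rvV2 = v\<rparr>)"

abbreviation ts_source where
  "ts_source p0 r pS \<equiv> pair_pmf (pair_pmf p0 (pair_pmf r r)) pS"

lemma UNIV_ts_index: "UNIV = {Q1, Q2, Q3}"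
  using ts_index.exhaust by blast

context
  fixes pS :: "'s::finite pmf"
    and W :: "'x::finite \<Rightarrow> 's \<Rightarrow> ('y::finite \<times> 'y) pmf"
    and y1 y2 :: "'x \<Rightarrow> 's \<Rightarrow> 'y"
  assumes W: "\<And>x s. W x s = return_pmf (y1 x s, y2 x s)"
begin

lemma mi_Y1_eq: "mi_Y1 pS W r = cond_ent pS r y1"
proof -
  \<comment> \<open>The constant \<open>()\<close> stands for conditioning on the state alone; its
    conditional entropy is 0.\<close>
  have "mi_Y1 pS W r = cond_ent pS r y1 - cond_ent pS r (\<lambda>_ _. ())"
    unfolding mi_Y1_def single_use_pmf_deterministic[of W y1 y2, OF W]
    by (rule cond_mi_eq_cond_ent[of "\<lambda>u. u"]) auto
  then show ?thesis by (simp add: cond_ent_const)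
qed

lemma mi_Y1_Y2_eq: "mi_Y1_Y2 pS W r = cond_ent pS r (\<lambda>x s. (y1 x s, y2 x s))"
proof -
  have "mi_Y1_Y2 pS W r = cond_ent pS r (\<lambda>x s. (y1 x s, y2 x s)) - cond_ent pS r (\<lambda>_ _. ())"
    unfolding mi_Y1_Y2_def single_use_pmf_deterministic[of W y1 y2, OF W]
    by (rule cond_mi_eq_cond_ent[of "\<lambda>u. u"]) auto
  then show ?thesis by (simp add: cond_ent_const)
qed

lemma mi_Y2_given_Y1_eq:
  "mi_Y2_given_Y1 pS W r = cond_ent pS r (\<lambda>x s. (y1 x s, y2 x s)) - cond_ent pS r y1"
  unfolding mi_Y2_given_Y1_def single_use_pmf_deterministic[of W y1 y2, OF W]
  by (rule cond_mi_eq_cond_ent[of "\<lambda>u. u"]) auto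

lemma joint_pmf_ts:
  "joint_pmf pS W (ts_auxiliaries y1 y2 pQ p0 r) =
     bind_pmf pQ (\<lambda>q. map_pmf (ts_outcome y1 y2 q) (ts_source p0 r pS))"
  by (simp add: joint_pmf_def ts_auxiliaries_def W ts_outcome_def Let_def pair_pmf_def map_bind_pmf
      bind_return_pmf bind_assoc_pmf)

lemma cond_mi_joint_pmf_ts:
  fixes p0 r :: "'x pmf" and X :: "_ \<Rightarrow> 'a::finite" and Y :: "_ \<Rightarrow> 'b::finite" and Z :: "_ \<Rightarrow> 'c::finite"
  assumes pQ: "ts_index_pmf p pQ"
  defines "K \<equiv> \<lambda>q. map_pmf (ts_outcome y1 y2 q) (ts_source p0 r pS)"
  shows "cond_mi (joint_pmf pS W (ts_auxiliaries y1 y2 pQ p0 r)) X Y (rvQ \<bowtie> Z) =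
    p * cond_mi (K Q1) X Y Z + p * cond_mi (K Q2) X Y Z + (1 - 2 * p) * cond_mi (K Q3) X Y Z"
proof -
  have "rvQ w = q" if "w \<in> set_pmf (K q)" for q w
    using that by (auto simp: K_def ts_outcome_def Let_def)
  then have "cond_mi (bind_pmf pQ K) X Y (rvQ \<bowtie> Z) = (\<Sum>q\<in>UNIV. pmf pQ q * cond_mi (K q) X Y Z)"
    by (intro cond_mi_bind_pmf)
  then show ?thesis
    unfolding joint_pmf_ts K_def[symmetric]
    using pQ by (simp add: UNIV_ts_index ts_index_pmf_def)
qed

end

lemma map_pmf_inj_eqI:
  assumes "bij f" "\<And>x. pmf N (f x) = pmf M x"
  shows "map_pmf f M = N"
proof (rule pmf_eqI)
  fix y
  obtain x where y: "y = f x" using assms(1) by (metis bij_pointE)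
  show "pmf (map_pmf f M) y = pmf N y"
    using assms by (simp add: y pmf_map_inj' bij_is_inj)
qed

lemma bij_if_inverse: "(\<And>x. g (f x) = x) \<Longrightarrow> (\<And>x. f (g x) = x) \<Longrightarrow> bij f"
  by (metis bij_def injI surjI)

section \<open>Laws of parts of the source, and the information terms phase by phase\<close>

context
  fixes p0 r :: "'x::finite pmf" and pS :: "'s::finite pmf" and y1 y2 :: "'x \<Rightarrow> 's \<Rightarrow> 'y::finite"
begin

text \<open>Brings the source into the product form required by \<open>cond_mi_eq_0_indep\<close>.
  Here U1 is split off; the variants below split off U2 or a pair containing U0.\<close>

lemma regroup_U1:
  "map_pmf (\<lambda>w.
      (case w of ((u0, u1, u2), s) \<Rightarrow> u1,
       case w of ((u0, u1, u2), s) \<Rightarrow> (u0, u2, s))) (ts_source p0 r pS)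
    = pair_pmf r (pair_pmf p0 (pair_pmf r pS))"
  by (rule map_pmf_inj_eqI[OF bij_if_inverse[where g = "\<lambda>(u1, u0, u2, s). ((u0, u1, u2), s)"]])
    (auto simp: pmf_pair split: prod.splits)

lemma regroup_U2:
  "map_pmf (\<lambda>w.
      (case w of ((u0, u1, u2), s) \<Rightarrow> u2,
       case w of ((u0, u1, u2), s) \<Rightarrow> (u0, u1, s))) (ts_source p0 r pS)
    = pair_pmf r (pair_pmf p0 (pair_pmf r pS))"
  by (rule map_pmf_inj_eqI[OF bij_if_inverse[where g = "\<lambda>(u2, u0, u1, s). ((u0, u1, u2), s)"]])
    (auto simp: pmf_pair split: prod.splits)

lemma regroup_U0_U1:
  "map_pmf (\<lambda>w.
      (case w of ((u0, u1, u2), s) \<Rightarrow> (u0, u1),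
       case w of ((u0, u1, u2), s) \<Rightarrow> (u2, s))) (ts_source p0 r pS)
    = pair_pmf (pair_pmf p0 r) (pair_pmf r pS)"
  by (rule map_pmf_inj_eqI[OF bij_if_inverse[where g = "\<lambda>((u0, u1), u2, s). ((u0, u1, u2), s)"]])
    (auto simp: pmf_pair split: prod.splits)

lemma regroup_U0_U2:
  "map_pmf (\<lambda>w.
      (case w of ((u0, u1, u2), s) \<Rightarrow> (u0, u2),
       case w of ((u0, u1, u2), s) \<Rightarrow> (u1, s))) (ts_source p0 r pS)
    = pair_pmf (pair_pmf p0 r) (pair_pmf r pS)"
  by (rule map_pmf_inj_eqI[OF bij_if_inverse[where g = "\<lambda>((u0, u2), u1, s). ((u0, u1, u2), s)"]])
    (auto simp: pmf_pair split: prod.splits)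

lemma marginal_U0: "map_pmf fst (pair_pmf p0 (pair_pmf r r)) = p0"
  and marginal_U1: "map_pmf (\<lambda>u. fst (snd u)) (pair_pmf p0 (pair_pmf r r)) = r"
  and marginal_U2: "map_pmf (\<lambda>u. snd (snd u)) (pair_pmf p0 (pair_pmf r r)) = r"
  and marginal_U0_U1: "map_pmf (\<lambda>u. (fst u, fst (snd u))) (pair_pmf p0 (pair_pmf r r)) = pair_pmf p0 r"
  and marginal_U0_U2: "map_pmf (\<lambda>u. (fst u, snd (snd u))) (pair_pmf p0 (pair_pmf r r)) = pair_pmf p0 r"
proof -
  show "map_pmf fst (pair_pmf p0 (pair_pmf r r)) = p0"
    by (simp add: map_fst_pair_pmf)
  have "map_pmf (\<lambda>u. fst (snd u)) (pair_pmf p0 (pair_pmf r r)) =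
      map_pmf fst (map_pmf snd (pair_pmf p0 (pair_pmf r r)))"
    "map_pmf (\<lambda>u. snd (snd u)) (pair_pmf p0 (pair_pmf r r)) =
      map_pmf snd (map_pmf snd (pair_pmf p0 (pair_pmf r r)))"
    by (simp_all only: map_pmf_comp)
  then show "map_pmf (\<lambda>u. fst (snd u)) (pair_pmf p0 (pair_pmf r r)) = r"
    "map_pmf (\<lambda>u. snd (snd u)) (pair_pmf p0 (pair_pmf r r)) = r"
    by (simp_all add: map_fst_pair_pmf map_snd_pair_pmf)
  have "map_pmf (\<lambda>u. (fst u, fst (snd u))) (pair_pmf p0 (pair_pmf r r)) =
      pair_pmf p0 (map_pmf fst (pair_pmf r r))"
    "map_pmf (\<lambda>u. (fst u, snd (snd u))) (pair_pmf p0 (pair_pmf r r)) =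
      pair_pmf p0 (map_pmf snd (pair_pmf r r))"
    by (simp_all add: pair_map_pmf2 apsnd_def map_prod_def case_prod_beta')
  then show "map_pmf (\<lambda>u. (fst u, fst (snd u))) (pair_pmf p0 (pair_pmf r r)) = pair_pmf p0 r"
    "map_pmf (\<lambda>u. (fst u, snd (snd u))) (pair_pmf p0 (pair_pmf r r)) = pair_pmf p0 r"
    by (simp_all add: map_fst_pair_pmf map_snd_pair_pmf)
qed

text \<open>Phase \<open>Q1\<close> sends U1 and has V = Y2, so receiver 1 obtains both
  outputs.\<close>

lemma mi_U0_U1_Q1:
  "cond_mi (map_pmf (ts_outcome y1 y2 Q1) (ts_source p0 r pS))
    (rvU0 \<bowtie> rvU1) (rvY1 \<bowtie> rvV1) rvS
    = cond_ent pS r (\<lambda>x s. (y1 x s, y2 x s))"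
  by (rule trans[OF cond_mi_eq_cond_ent[OF marginal_U1,
        where f = "\<lambda>x s. (y1 x s, y2 x s)" and f' = "\<lambda>_ _. ()"]])
    (auto simp: ts_outcome_def Let_def cond_ent_const)

text \<open>Phase \<open>Q2\<close> sends U2, which together with the state is independent of (U0,
  U1).\<close>

lemma mi_U0_U1_Q2:
  "cond_mi (map_pmf (ts_outcome y1 y2 Q2) (ts_source p0 r pS))
    (rvU0 \<bowtie> rvU1) (rvY1 \<bowtie> rvV1) rvS
    = 0"
  by (rule cond_mi_eq_0_indep[OF regroup_U0_U1]) (auto simp: ts_outcome_def Let_def)

text \<open>Phase \<open>Q3\<close> sends U0 and has constant V, so only Y1 informs.\<close>

lemma mi_U0_U1_Q3:
  "cond_mi (map_pmf (ts_outcome y1 y2 Q3) (ts_source p0 r pS))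
    (rvU0 \<bowtie> rvU1) (rvY1 \<bowtie> rvV1) rvS
    = cond_ent pS p0 y1"
  by (rule trans[OF cond_mi_eq_cond_ent[OF marginal_U0,
        where f = "y1" and f' = "\<lambda>_ _. ()"]])
    (auto simp: ts_outcome_def Let_def cond_ent_const)

text \<open>The cost of describing Y2 to a receiver that knows Y1 and the state.\<close>

lemma mi_V0_V1_given_Y1_Q1:
  "cond_mi (map_pmf (ts_outcome y1 y2 Q1) (ts_source p0 r pS))
    (rvU0 \<bowtie> rvU1 \<bowtie> rvU2) (rvV0 \<bowtie> rvV1) (rvY1 \<bowtie> rvS)
    = cond_ent pS r (\<lambda>x s. (y1 x s, y2 x s)) - cond_ent pS r y1"
  by (rule trans[OF cond_mi_eq_cond_ent[OF marginal_U1,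
        where f = "\<lambda>x s. (y1 x s, y2 x s)" and f' = "y1"]])
    (auto simp: ts_outcome_def Let_def cond_ent_const)

text \<open>In phase \<open>Q2\<close> the description is Y1 itself, which receiver 1 already
  has.\<close>

lemma mi_V0_V1_given_Y1_Q2:
  "cond_mi (map_pmf (ts_outcome y1 y2 Q2) (ts_source p0 r pS))
    (rvU0 \<bowtie> rvU1 \<bowtie> rvU2) (rvV0 \<bowtie> rvV1) (rvY1 \<bowtie> rvS)
    = 0"
  by (rule cond_mi_eq_0_function) (auto simp: ts_outcome_def Let_def)

lemma mi_V0_V1_given_Y1_Q3:
  "cond_mi (map_pmf (ts_outcome y1 y2 Q3) (ts_source p0 r pS))
    (rvU0 \<bowtie> rvU1 \<bowtie> rvU2) (rvV0 \<bowtie> rvV1) (rvY1 \<bowtie> rvS)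
    = 0"
  by (rule cond_mi_eq_0_function) (auto simp: ts_outcome_def Let_def)

lemma mi_V0_given_Y1_Q1:
  "cond_mi (map_pmf (ts_outcome y1 y2 Q1) (ts_source p0 r pS))
    (rvU0 \<bowtie> rvU1 \<bowtie> rvU2) rvV0 (rvY1 \<bowtie> rvS)
    = cond_ent pS r (\<lambda>x s. (y1 x s, y2 x s)) - cond_ent pS r y1"
  by (rule trans[OF cond_mi_eq_cond_ent[OF marginal_U1,
        where f = "\<lambda>x s. (y1 x s, y2 x s)" and f' = "y1"]])
    (auto simp: ts_outcome_def Let_def cond_ent_const)

lemma mi_V0_given_Y1_Q2:
  "cond_mi (map_pmf (ts_outcome y1 y2 Q2) (ts_source p0 r pS))
    (rvU0 \<bowtie> rvU1 \<bowtie> rvU2) rvV0 (rvY1 \<bowtie> rvS)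
    = 0"
  by (rule cond_mi_eq_0_function) (auto simp: ts_outcome_def Let_def)

lemma mi_V0_given_Y1_Q3:
  "cond_mi (map_pmf (ts_outcome y1 y2 Q3) (ts_source p0 r pS))
    (rvU0 \<bowtie> rvU1 \<bowtie> rvU2) rvV0 (rvY1 \<bowtie> rvS)
    = 0"
  by (rule cond_mi_eq_0_function) (auto simp: ts_outcome_def Let_def)

text \<open>U0 is independent of the input U1; its entropy enters both conditional entropies and
  cancels.\<close>

lemma mi_U1_given_U0_Q1:
  "cond_mi (map_pmf (ts_outcome y1 y2 Q1) (ts_source p0 r pS))
    rvU1 (rvY1 \<bowtie> rvV1) (rvU0 \<bowtie> rvS)
    = cond_ent pS r (\<lambda>x s. (y1 x s, y2 x s))"
  by (rule trans[OF cond_mi_eq_cond_ent[OF marginal_U0_U1,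
        where f = "\<lambda>u s. (fst u, y1 (snd u) s, y2 (snd u) s)" and f' = "\<lambda>u s. fst u"]])
    (auto simp: ts_outcome_def Let_def cond_ent_pair_pmf[where f = "\<lambda>x s. (y1 x s, y2 x s)"] cond_ent_pair_pmf_fst)

lemma mi_U1_given_U0_Q2:
  "cond_mi (map_pmf (ts_outcome y1 y2 Q2) (ts_source p0 r pS))
    rvU1 (rvY1 \<bowtie> rvV1) (rvU0 \<bowtie> rvS)
    = 0"
  by (rule cond_mi_eq_0_indep[OF regroup_U1]) (auto simp: ts_outcome_def Let_def)

lemma mi_U1_given_U0_Q3:
  "cond_mi (map_pmf (ts_outcome y1 y2 Q3) (ts_source p0 r pS))
    rvU1 (rvY1 \<bowtie> rvV1) (rvU0 \<bowtie> rvS)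
    = 0"
  by (rule cond_mi_eq_0_function) (auto simp: ts_outcome_def Let_def)

lemma mi_U0_Y1_Q1:
  "cond_mi (map_pmf (ts_outcome y1 y2 Q1) (ts_source p0 r pS))
    rvU0 (rvY1 \<bowtie> rvV1) rvS
    = 0"
  by (rule cond_mi_eq_0_indep[OF regroup_U0_U2]) (auto simp: ts_outcome_def Let_def)

lemma mi_U0_Y1_Q2:
  "cond_mi (map_pmf (ts_outcome y1 y2 Q2) (ts_source p0 r pS))
    rvU0 (rvY1 \<bowtie> rvV1) rvS
    = 0"
  by (rule cond_mi_eq_0_indep[OF regroup_U0_U1]) (auto simp: ts_outcome_def Let_def)

lemma mi_U0_Y1_Q3:
  "cond_mi (map_pmf (ts_outcome y1 y2 Q3) (ts_source p0 r pS))
    rvU0 (rvY1 \<bowtie> rvV1) rvS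
    = cond_ent pS p0 y1"
  by (rule trans[OF cond_mi_eq_cond_ent[OF marginal_U0,
        where f = "y1" and f' = "\<lambda>_ _. ()"]])
    (auto simp: ts_outcome_def Let_def cond_ent_const)

text \<open>V1 and V0 coincide in every phase.\<close>

lemma mi_V1_given_V0:
  "cond_mi (map_pmf (ts_outcome y1 y2 q) (ts_source p0 r pS))
    (rvU0 \<bowtie> rvU1 \<bowtie> rvU2) rvV1 (rvV0 \<bowtie> rvY1 \<bowtie> rvS)
    = 0"
  by (rule cond_mi_eq_0_function) (auto simp: ts_outcome_def Let_def)

section \<open>Mirrored terms of the second receiver, and the independence of U1 and U2\<close>

lemma mi_U0_U2_Q2:
  "cond_mi (map_pmf (ts_outcome y1 y2 Q2) (ts_source p0 r pS))
    (rvU0 \<bowtie> rvU2) (rvY2 \<bowtie> rvV2) rvS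
    = cond_ent pS r (\<lambda>x s. (y1 x s, y2 x s))"
  by (rule trans[OF cond_mi_eq_cond_ent[OF marginal_U2,
        where f = "\<lambda>x s. (y1 x s, y2 x s)" and f' = "\<lambda>_ _. ()"]])
    (auto simp: ts_outcome_def Let_def cond_ent_const)

lemma mi_U0_U2_Q1:
  "cond_mi (map_pmf (ts_outcome y1 y2 Q1) (ts_source p0 r pS))
    (rvU0 \<bowtie> rvU2) (rvY2 \<bowtie> rvV2) rvS
    = 0"
  by (rule cond_mi_eq_0_indep[OF regroup_U0_U2]) (auto simp: ts_outcome_def Let_def)

lemma mi_U0_U2_Q3:
  "cond_mi (map_pmf (ts_outcome y1 y2 Q3) (ts_source p0 r pS))
    (rvU0 \<bowtie> rvU2) (rvY2 \<bowtie> rvV2) rvS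
    = cond_ent pS p0 y2"
  by (rule trans[OF cond_mi_eq_cond_ent[OF marginal_U0,
        where f = "y2" and f' = "\<lambda>_ _. ()"]])
    (auto simp: ts_outcome_def Let_def cond_ent_const)

lemma mi_V0_V2_given_Y2_Q2:
  "cond_mi (map_pmf (ts_outcome y1 y2 Q2) (ts_source p0 r pS))
    (rvU0 \<bowtie> rvU1 \<bowtie> rvU2) (rvV0 \<bowtie> rvV2) (rvY2 \<bowtie> rvS)
    = cond_ent pS r (\<lambda>x s. (y1 x s, y2 x s)) - cond_ent pS r y2"
  by (rule trans[OF cond_mi_eq_cond_ent[OF marginal_U2,
        where f = "\<lambda>x s. (y1 x s, y2 x s)" and f' = "y2"]])
    (auto simp: ts_outcome_def Let_def cond_ent_const)

lemma mi_V0_V2_given_Y2_Q1: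
  "cond_mi (map_pmf (ts_outcome y1 y2 Q1) (ts_source p0 r pS))
    (rvU0 \<bowtie> rvU1 \<bowtie> rvU2) (rvV0 \<bowtie> rvV2) (rvY2 \<bowtie> rvS)
    = 0"
  by (rule cond_mi_eq_0_function) (auto simp: ts_outcome_def Let_def)

lemma mi_V0_V2_given_Y2_Q3:
  "cond_mi (map_pmf (ts_outcome y1 y2 Q3) (ts_source p0 r pS))
    (rvU0 \<bowtie> rvU1 \<bowtie> rvU2) (rvV0 \<bowtie> rvV2) (rvY2 \<bowtie> rvS)
    = 0"
  by (rule cond_mi_eq_0_function) (auto simp: ts_outcome_def Let_def)

lemma mi_V0_given_Y2_Q2:
  "cond_mi (map_pmf (ts_outcome y1 y2 Q2) (ts_source p0 r pS))
    (rvU0 \<bowtie> rvU1 \<bowtie> rvU2) rvV0 (rvY2 \<bowtie> rvS)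
    = cond_ent pS r (\<lambda>x s. (y1 x s, y2 x s)) - cond_ent pS r y2"
  by (rule trans[OF cond_mi_eq_cond_ent[OF marginal_U2,
        where f = "\<lambda>x s. (y1 x s, y2 x s)" and f' = "y2"]])
    (auto simp: ts_outcome_def Let_def cond_ent_const)

lemma mi_V0_given_Y2_Q1:
  "cond_mi (map_pmf (ts_outcome y1 y2 Q1) (ts_source p0 r pS))
    (rvU0 \<bowtie> rvU1 \<bowtie> rvU2) rvV0 (rvY2 \<bowtie> rvS)
    = 0"
  by (rule cond_mi_eq_0_function) (auto simp: ts_outcome_def Let_def)

lemma mi_V0_given_Y2_Q3:
  "cond_mi (map_pmf (ts_outcome y1 y2 Q3) (ts_source p0 r pS))
    (rvU0 \<bowtie> rvU1 \<bowtie> rvU2) rvV0 (rvY2 \<bowtie> rvS)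
    = 0"
  by (rule cond_mi_eq_0_function) (auto simp: ts_outcome_def Let_def)

lemma mi_U2_given_U0_Q2:
  "cond_mi (map_pmf (ts_outcome y1 y2 Q2) (ts_source p0 r pS))
    rvU2 (rvY2 \<bowtie> rvV2) (rvU0 \<bowtie> rvS)
    = cond_ent pS r (\<lambda>x s. (y1 x s, y2 x s))"
  by (rule trans[OF cond_mi_eq_cond_ent[OF marginal_U0_U2,
        where f = "\<lambda>u s. (fst u, y1 (snd u) s, y2 (snd u) s)" and f' = "\<lambda>u s. fst u"]])
    (auto simp: ts_outcome_def Let_def cond_ent_pair_pmf[where f = "\<lambda>x s. (y1 x s, y2 x s)"] cond_ent_pair_pmf_fst)

lemma mi_U2_given_U0_Q1:
  "cond_mi (map_pmf (ts_outcome y1 y2 Q1) (ts_source p0 r pS))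
    rvU2 (rvY2 \<bowtie> rvV2) (rvU0 \<bowtie> rvS)
    = 0"
  by (rule cond_mi_eq_0_indep[OF regroup_U2]) (auto simp: ts_outcome_def Let_def)

lemma mi_U2_given_U0_Q3:
  "cond_mi (map_pmf (ts_outcome y1 y2 Q3) (ts_source p0 r pS))
    rvU2 (rvY2 \<bowtie> rvV2) (rvU0 \<bowtie> rvS)
    = 0"
  by (rule cond_mi_eq_0_function) (auto simp: ts_outcome_def Let_def)

lemma mi_U0_Y2_Q1:
  "cond_mi (map_pmf (ts_outcome y1 y2 Q1) (ts_source p0 r pS))
    rvU0 (rvY2 \<bowtie> rvV2) rvS
    = 0"
  by (rule cond_mi_eq_0_indep[OF regroup_U0_U2]) (auto simp: ts_outcome_def Let_def)

lemma mi_U0_Y2_Q2: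
  "cond_mi (map_pmf (ts_outcome y1 y2 Q2) (ts_source p0 r pS))
    rvU0 (rvY2 \<bowtie> rvV2) rvS
    = 0"
  by (rule cond_mi_eq_0_indep[OF regroup_U0_U1]) (auto simp: ts_outcome_def Let_def)

lemma mi_U0_Y2_Q3:
  "cond_mi (map_pmf (ts_outcome y1 y2 Q3) (ts_source p0 r pS))
    rvU0 (rvY2 \<bowtie> rvV2) rvS
    = cond_ent pS p0 y2"
  by (rule trans[OF cond_mi_eq_cond_ent[OF marginal_U0,
        where f = "y2" and f' = "\<lambda>_ _. ()"]])
    (auto simp: ts_outcome_def Let_def cond_ent_const)

lemma mi_V2_given_V0:
  "cond_mi (map_pmf (ts_outcome y1 y2 q) (ts_source p0 r pS))
    (rvU0 \<bowtie> rvU1 \<bowtie> rvU2) rvV2 (rvV0 \<bowtie> rvY2 \<bowtie> rvS)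
    = 0"
  by (rule cond_mi_eq_0_function) (auto simp: ts_outcome_def Let_def)

lemma mi_U1_U2:
  "cond_mi (map_pmf (ts_outcome y1 y2 q) (ts_source p0 r pS))
    rvU1 rvU2 rvU0
    = 0"
  by (rule cond_mi_eq_0_indep[OF regroup_U1]) (auto simp: ts_outcome_def Let_def)

end

text \<open>In the individual bounds the gain \<open>p * J r\<close> minus the description cost
  leaves \<open>p * cond_ent pS r y1\<close>. By \<open>sym\<close> these two bounds coincide, and
  the last sum bound is their double. In the first sum bound the description cost is paid only once,
  which gives the other condition.\<close>

lemma sw_inequalities_ts_iff:
  fixes pS :: "'s::finite pmf" and y1 y2 :: "'x::finite \<Rightarrow> 's \<Rightarrow> 'y::finite"
  assumes W: "\<And>x s. W x s = return_pmf (y1 x s, y2 x s)"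
    and pQ: "ts_index_pmf p pQ"
    and sym: "\<And>r. cond_ent pS r y2 = cond_ent pS r y1"
  defines "J \<equiv> \<lambda>r. cond_ent pS r (\<lambda>x s. (y1 x s, y2 x s))"
  shows "sw_inequalities pS W (ts_auxiliaries y1 y2 pQ p0 r) R R \<longleftrightarrow>
    0 \<le> R \<and> R \<le> p * cond_ent pS r y1 + (1 - 2 * p) * cond_ent pS p0 y1 \<and>
    2 * R \<le> p * J r + p * cond_ent pS r y1 + (1 - 2 * p) * cond_ent pS p0 y1"
  unfolding sw_inequalities_def Let_def cond_mi_joint_pmf_ts[OF W pQ]
  by (simp add: mi_U0_U1_Q1 mi_U0_U1_Q2 mi_U0_U1_Q3 mi_V0_V1_given_Y1_Q1
    mi_V0_V1_given_Y1_Q2 mi_V0_V1_given_Y1_Q3 mi_V0_given_Y1_Q1 mi_V0_given_Y1_Q2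
    mi_V0_given_Y1_Q3 mi_U1_given_U0_Q1 mi_U1_given_U0_Q2 mi_U1_given_U0_Q3
    mi_U0_Y1_Q1 mi_U0_Y1_Q2 mi_U0_Y1_Q3 mi_V1_given_V0
    mi_U0_U2_Q2 mi_U0_U2_Q1 mi_U0_U2_Q3 mi_V0_V2_given_Y2_Q2
    mi_V0_V2_given_Y2_Q1 mi_V0_V2_given_Y2_Q3 mi_V0_given_Y2_Q2 mi_V0_given_Y2_Q1
    mi_V0_given_Y2_Q3 mi_U2_given_U0_Q2 mi_U2_given_U0_Q1 mi_U2_given_U0_Q3
    mi_U0_Y2_Q1 mi_U0_Y2_Q2 mi_U0_Y2_Q3 mi_V2_given_V0
    mi_U1_U2
    sym J_def) (auto simp: algebra_simps)

text \<open>Relabelling the states by the bijection turns \<open>y2\<close> into \<open>y1\<close>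
  and preserves \<open>pS\<close>, so the averages over states agree.\<close>

lemma cond_ent_snd_eq_fst:
  assumes "symmetric_bc pS W" and W: "\<And>x s. W x s = return_pmf (y1 x s, y2 x s)"
  shows "cond_ent pS r y2 = cond_ent pS r y1"
proof -
  obtain \<pi> where \<pi>: "bij \<pi>" "\<And>s. pmf pS s = pmf pS (\<pi> s)"
    "\<And>x y s. pmf (map_pmf fst (W x s)) y = pmf (map_pmf snd (W x (\<pi> s))) y"
    using assms(1) by (auto simp: symmetric_bc_def)
  have "y1 x s = y2 x (\<pi> s)" for x s
    using pmf_eqI[OF \<pi>(3)[of x s]] by (simp add: W)
  then have "cond_ent pS r y1 = (\<Sum>s\<in>UNIV. pmf pS (\<pi> s) * ent r (\<lambda>x. y2 x (\<pi> s)))"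
    by (simp add: cond_ent_def flip: \<pi>(2))
  also have "\<dots> = cond_ent pS r y2"
    unfolding cond_ent_def by (rule sum.reindex_bij_betw[OF \<pi>(1)])
  finally show ?thesis by simp
qed

lemma ts_index_pmf_exists:
  assumes "0 \<le> p" "p \<le> 1 / 2"
  shows "\<exists>pQ. ts_index_pmf p pQ"
proof -
  define f where "f q = (case q of Q3 \<Rightarrow> 1 - 2 * p | _ \<Rightarrow> p)" for q
  have nn: "0 \<le> f q" for q using assms by (simp add: f_def split: ts_index.split)
  have "(\<integral>\<^sup>+ q. ennreal (f q) \<partial>count_space UNIV) = ennreal (\<Sum>q\<in>UNIV. f q)"
    using nn by (simp add: nn_integral_count_space_finite sum_ennreal)
  also have "\<dots> = 1" by (simp add: UNIV_ts_index f_def)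
  finally have "pmf (embed_pmf f) q = f q" for q
    using nn by (intro pmf_embed_pmf) auto
  then have "ts_index_pmf p (embed_pmf f)"
    using assms by (simp add: ts_index_pmf_def f_def)
  then show ?thesis ..
qed

section \<open>The symmetric rate\<close>

text \<open>\<open>a\<close>, \<open>c\<close>, \<open>d\<close> stand for A(r), C1, D(r). The first
  bound decreases in \<open>p\<close>; the sign of the slope \<open>2 * a + d - 2 * c\<close> of the
  second decides whether the crossing or \<open>p = 0\<close> matters.\<close>

lemma min_affine_le_crossing:
  fixes a c d p R :: real
  assumes "0 \<le> a" "a \<le> c" "0 \<le> d" "0 \<le> p" "p \<le> 1 / 2" "0 < c"
    and R1: "R \<le> p * a + (1 - 2 * p) * c"
    and R2: "2 * R \<le> p * (a + d) + p * a + (1 - 2 * p) * c"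
  shows "R \<le> c * (a + d) / (2 * c + d) \<or> R \<le> c / 2"
proof -
  \<comment> \<open>The crossing point: at \<open>p = t\<close> both bounds on \<open>R\<close>
    equal \<open>t * (a + d)\<close>.\<close>
  define t where "t = c / (2 * c + d)"
  have den: "0 < 2 * c + d" using assms by simp
  have t: "t * (2 * c + d) = c" using den by (simp add: t_def)
  have val: "c * (a + d) / (2 * c + d) = t * (a + d)" by (simp add: t_def)
  show ?thesis
  proof (cases "p \<ge> t \<or> 2 * a + d \<ge> 2 * c")
    case True
    have "R \<le> t * (a + d)"
    proof (cases "p \<ge> t")
      case True
      then have "0 \<le> (p - t) * (2 * c - a)" using assms by simp
      with R1 t show ?thesis by (simp add: algebra_simps)
    next
      case False
      then have "0 \<le> (t - p) * (2 * a + d - 2 * c)" using True by simp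
      with R2 t show ?thesis by (simp add: algebra_simps)
    qed
    then show ?thesis by (simp add: val)
  next
    case False
    \<comment> \<open>The second bound is decreasing here, so \<open>2 * R\<close> is at most its
      value \<open>c\<close> at \<open>p = 0\<close>.\<close>
    then have "0 \<le> p * (2 * c - 2 * a - d)" using assms by simp
    with R2 show ?thesis by (simp add: algebra_simps)
  qed
qed

theorem proposition1:
  fixes pS :: "'s::finite pmf"
    and W :: "'x::finite \<Rightarrow> 's \<Rightarrow> ('y::finite \<times> 'y) pmf"
    and y1 y2 :: "'x \<Rightarrow> 's \<Rightarrow> 'y"
  assumes "symmetric_deterministic_bc pS W y1 y2"
  shows "is_maximum (range (mi_Y1 pS W)) (C1 pS W) \<and>
         is_maximum (ts_symmetric_rates pS W y1 y2) (R_sym_ts pS W y1 y2) \<and>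
         is_maximum
           (range (\<lambda>pX. C1 pS W * mi_Y1_Y2 pS W pX / (2 * C1 pS W + mi_Y2_given_Y1 pS W pX)))
           (R_sym_ts pS W y1 y2)"
proof -
  have W: "\<And>x s. W x s = return_pmf (y1 x s, y2 x s)" and "symmetric_bc pS W"
    using assms by (auto simp: symmetric_deterministic_bc_def)
  then have sym: "cond_ent pS r y2 = cond_ent pS r y1" for r
    by (intro cond_ent_snd_eq_fst)
  define A where "A r = cond_ent pS r y1" for r
  define J where "J r = cond_ent pS r (\<lambda>x s. (y1 x s, y2 x s))" for r
  define D where "D r = J r - A r" for r
  have mi: "mi_Y1 pS W r = A r" "mi_Y1_Y2 pS W r = J r" "mi_Y2_given_Y1 pS W r = D r" for r
    by (simp_all add: A_def J_def D_def mi_Y1_eq[OF W] mi_Y1_Y2_eq[OF W] mi_Y2_given_Y1_eq[OF W])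
  have A_nonneg: "0 \<le> A r" for r
    by (simp add: A_def cond_ent_nonneg)
  have D_nonneg: "0 \<le> D r" for r
    unfolding mi(3)[symmetric] mi_Y2_given_Y1_def by (rule cond_mi_nonneg)
  obtain r1 where r1: "\<And>r. A r \<le> A r1"
    using pmf_maximum_exists[OF continuous_on_cond_ent_vec, of A pS y1] by (auto simp: A_def cond_ent_eq_vec)
  have C1: "C1 pS W = A r1"
    unfolding C1_def mi using r1 by (intro cSup_eq_maximum) auto
  define G where "G r = A r1 * J r / (2 * A r1 + D r)" for r
  obtain r2 where r2: "\<And>r. G r \<le> G r2"
  \<comment> \<open>If \<open>A r1 = 0\<close>, the numerator of \<open>G\<close> vanishes
    identically and any pmf is a maximizer. Otherwise the denominator is positive on the simplex and
    the quotient is continuous.\<close>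
  proof (cases "A r1 = 0")
    case True
    then show ?thesis using that by (simp add: G_def)
  next
    case False
    then have pos: "0 < 2 * A r1 + D r" for r
      using A_nonneg[of r1] D_nonneg[of r] by simp
    let ?J = "cond_ent_vec pS (\<lambda>x s. (y1 x s, y2 x s))"
    let ?den = "\<lambda>v. 2 * A r1 + (?J v - cond_ent_vec pS y1 v)"
    have "?den v \<noteq> 0" if "v \<in> prob_simplex" for v
      by (rule simplex_vec_pmfE[OF that]) (use pos in \<open>simp add: D_def J_def A_def cond_ent_eq_vec less_imp_neq[symmetric]\<close>)
    then have "continuous_on prob_simplex (\<lambda>v. A r1 * ?J v / ?den v)"
      by (intro continuous_intros continuous_on_cond_ent_vec) auto
    then show ?thesis
      using pmf_maximum_exists[of "\<lambda>v. A r1 * ?J v / ?den v" G] that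
      by (auto simp: G_def D_def J_def A_def cond_ent_eq_vec)
  qed
  have rates: "R \<in> ts_symmetric_rates pS W y1 y2 \<longleftrightarrow> (\<exists>p p0 r. 0 \<le> p \<and> p \<le> 1 / 2 \<and> 0 \<le> R \<and>
      R \<le> p * A r + (1 - 2 * p) * A p0 \<and> 2 * R \<le> p * J r + p * A r + (1 - 2 * p) * A p0)" for R
  proof -
    have "R \<in> ts_symmetric_rates pS W y1 y2 \<longleftrightarrow> (\<exists>p pQ p0 r. ts_index_pmf p pQ \<and> 0 \<le> R \<and>
      R \<le> p * A r + (1 - 2 * p) * A p0 \<and> 2 * R \<le> p * J r + p * A r + (1 - 2 * p) * A p0)"
      unfolding ts_symmetric_rates_def A_def J_def
      using sw_inequalities_ts_iff[OF W _ sym] by blast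
    \<comment> \<open>Every \<open>p\<close> in the interval is realised by some phase pmf, so
      \<open>pQ\<close> can be eliminated.\<close>
    then show ?thesis
      using ts_index_pmf_exists by (auto simp: ts_index_pmf_def) blast
  qed
  have upper: "R \<le> G r2" if R: "R \<in> ts_symmetric_rates pS W y1 y2" for R
  proof -
    obtain p p0 r where p: "0 \<le> p" "p \<le> 1 / 2"
      and R: "R \<le> p * A r + (1 - 2 * p) * A p0" "2 * R \<le> p * J r + p * A r + (1 - 2 * p) * A p0"
      using R unfolding rates by blast
    \<comment> \<open>The weight is nonnegative, so replacing \<open>p0\<close> by the maximizer
      \<open>r1\<close> only relaxes both bounds.\<close>
    have "(1 - 2 * p) * A p0 \<le> (1 - 2 * p) * A r1"
      using p r1 by (intro mult_left_mono) auto
    then have R': "R \<le> p * A r + (1 - 2 * p) * A r1"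
      "2 * R \<le> p * (A r + D r) + p * A r + (1 - 2 * p) * A r1"
      using R by (simp_all add: D_def)
    show ?thesis
    proof (cases "A r1 = 0")
      case True
      then have "A r = 0" using r1[of r] A_nonneg[of r] by simp
      then show ?thesis using R' True by (simp add: G_def)
    next
      case False
      then have pos: "0 < A r1" using A_nonneg[of r1] by simp
      \<comment> \<open>\<open>J r1 = A r1 + D r1\<close> is at least half of the denominator
        \<open>2 * A r1 + D r1\<close>; this absorbs the alternative \<open>p = 0\<close>.\<close>
      have "A r1 / 2 \<le> G r1"
        using pos D_nonneg[of r1] by (simp add: G_def D_def field_simps)
      moreover have "R \<le> G r \<or> R \<le> A r1 / 2"
        using min_affine_le_crossing[OF A_nonneg r1 D_nonneg p pos R'] by (simp add: G_def D_def)
      ultimately show ?thesis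
        using r2[of r] r2[of r1] by linarith
    qed
  qed
  have attained: "G r2 \<in> ts_symmetric_rates pS W y1 y2"
  proof -
    \<comment> \<open>The crossing point for \<open>r2\<close>. A zero denominator forces
      \<open>A r1 = 0\<close>, and division by zero then gives \<open>p = 0\<close>, which still
      serves.\<close>
    define p where "p = A r1 / (2 * A r1 + D r2)"
    have p: "0 \<le> p" "p \<le> 1 / 2"
      using A_nonneg[of r1] D_nonneg[of r2] by (auto simp: p_def divide_simps)
    have G: "G r2 = p * J r2" by (simp add: G_def p_def)
    have J: "J r2 = A r2 + D r2" by (simp add: D_def)
    have "p * (2 * A r1 + D r2) = A r1"
      using A_nonneg[of r1] D_nonneg[of r2] by (auto simp: p_def)
    \<comment> \<open>By this identity both bounds hold with equality at
      \<open>G r2\<close>.\<close>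
    then have eq: "p * D r2 = (1 - 2 * p) * A r1"
      by (simp add: algebra_simps)
    have "0 \<le> G r2" using p A_nonneg[of r2] D_nonneg[of r2] by (simp add: G J)
    moreover have "G r2 = p * A r2 + (1 - 2 * p) * A r1"
      by (simp add: G J distrib_left eq)
    moreover have "2 * G r2 = p * J r2 + p * A r2 + (1 - 2 * p) * A r1"
      by (simp add: G J distrib_left flip: eq)
    ultimately show ?thesis
      unfolding rates using p by (intro exI[of _ p] exI[of _ r1] exI[of _ r2]) simp
  qed
  have "R_sym_ts pS W y1 y2 = G r2"
    unfolding R_sym_ts_def by (intro cSup_eq_maximum attained upper)
  then show ?thesis
    using r1 r2 upper attained by (auto simp: is_maximum_def mi C1 G_def)
qed

end
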